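(* Let $\mathcal{K}\subseteq\mathbb{R}^m$ be a regular closed convex cone, let $e\in\operatorname{int}\mathcal{K}$ and $c_D>0$. Let $f:\mathbb{R}^n\to\mathbb{R}$ be a closed proper $\mu$-strongly convex function ($\mu>0$), $T:\mathbb{R}^n\to\mathbb{R}^m$ a linear map, $b\in\mathbb{R}^m$, let $y_k\in\mathcal{K}^*$ satisfy $\langle e,y_k\rangle\le c_D$ and let $x_k=\nabla f^*(T^*y_k)$. Consider the primal problem $$(\mathrm{S})\quad \min_{s\in\mathbb{R}^m,\alpha\in\mathbb{R}}\ \langle Tx_k+b,s\rangle\quad\text{s.t. } \langle e,s\rangle+\alpha=c_D,\ s\in\mathcal{K}^*,\ \alpha\ge 0,$$ and its dual $$(\mathrm{S}^* )\quad \max_{t\in\mathbb{R},z\in\mathbb{R}^m}\ c_D t\quad\text{s.t. } z=(Tx_k+b)-te,\ z\in\mathcal{K},\ t\le 0.$$ Then the following statements hold. (i) Both $(\mathrm{S})$ and $(\mathrm{S}^* )$ satisfy Slater's condition. In particular, the optimal values of both problems coincide and are attained. (ii) The optimal solution of $(\mathrm{S}^* )$ is given by $t_{\mathrm{opt}}=\min(0,\lambda_{\min}(Tx_k+b))$ and $z_{\mathrm{opt}}=Tx_k+b-t_{\mathrm{opt}}e$, where $\lambda_{\min}$ is the minimum eigenvalue function with respect to $\mathcal{K}$ and $e$. (iii) If $t_{\mathrm{opt}}=0$, then $(s,\alpha)=(0,c_D)\in\mathbb{R}^m\times\mathbb{R}$ is an optimal solution to $(\mathrm{S})$. Otherwise,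 if $t_{\mathrm{opt}}<0$, the optimal solution set of $(\mathrm{S})$ with respect to the $s$ variable is $$\{s\in\mathcal{K}^*\mid\langle e,s\rangle=c_D,\ \langle s,z_{\mathrm{opt}}\rangle=0\}=\{s\in\mathcal{F}_{z_{\mathrm{opt}}}^{\Delta}\mid\langle e,s\rangle=c_D\}.$$
   Context: $\mathbb{R}^n$ and $\mathbb{R}^m$ carry arbitrary inner products $\langle\cdot,\cdot\rangle$ with induced norms $\|\cdot\|$; adjoints, conjugates, gradients and dual cones are taken with respect to them. A closed convex cone $\mathcal{K}$ is regular if it is pointed ($\mathcal{K}\cap-\mathcal{K}=\{0\}$) and has nonempty interior. Its dual cone is $\mathcal{K}^*=\{y\mid\langle x,y\rangle\ge 0\ \forall x\in\mathcal{K}\}$. $f$ is $\mu$-strongly convex if $f(\theta x+(1-\theta)y)\le\theta f(x)+(1-\theta)f(y)-\frac{\mu}{2}\theta(1-\theta)\|x-y\|^2$ for all $x,y$ and $\theta\in[0,1]$. $f^*(s)=\sup_x\{\langle s,x\rangle-f(x)\}$ is the conjugate; it is finite and differentiable on $\mathbb{R}^n$ here. The minimum eigenvalue function with respect to $\mathcal{K}$ and $e\in\operatorname{int}\mathcal{K}$ is $\lambda_{\min}(x)=\sup\{t\in\mathbb{R}\mid x-te\in\mathcal{K}\}$. For $z\in\mathcal{K}$, the conjugate face at $z$ is $\mathcal{F}_z^{\Delta}=\{y\in\mathcal{K}^*\mid\langle y,z\rangle=0\}$. Slater's condition for $(\mathrm{S})$ means that there is a feasible $(s,\alpha)$ with $s\in\operatorname{int}\mathcal{K}^*$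 and $\alpha>0$; for $(\mathrm{S}^* )$, that there is a feasible $(t,z)$ with $z\in\operatorname{int}\mathcal{K}$ and $t<0$. The optimal solution set with respect to the $s$ variable is the set of $s$ such that $(s,\alpha)$ is optimal for some $\alpha$. *)

theory Defs
  imports "HOL-Analysis.Analysis"
begin

text \<open>The inner product, norm and topology are those of the abstract class
  \<^class>\<open>euclidean_space\<close>: a nontrivial finite-dimensional real space with some inner product.\<close>

definition regular_cone :: "'b::euclidean_space set \<Rightarrow> bool" where
  "regular_cone K \<longleftrightarrow> K \<inter> uminus ` K = {0} \<and> interior K \<noteq> {}"

definition dual_cone :: "'b::euclidean_space set \<Rightarrow> 'b set" where
  "dual_cone K = {y. \<forall>x\<in>K. x \<bullet> y \<ge> 0}"

definition conjugate_face :: "'b::euclidean_space set \<Rightarrow> 'b \<Rightarrow> 'b set" where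
  "conjugate_face K z = {y \<in> dual_cone K. y \<bullet> z = 0}"

text \<open>For a regular closed convex cone \<open>K\<close> and \<open>e\<close> in its interior this set of reals
  is nonempty and bounded above, so the real supremum is the genuine one.\<close>

definition min_eigenvalue :: "'b::euclidean_space set \<Rightarrow> 'b \<Rightarrow> 'b \<Rightarrow> real" where
  "min_eigenvalue K e x = Sup {t. x - t *\<^sub>R e \<in> K}"

definition strongly_convex :: "real \<Rightarrow> ('a::euclidean_space \<Rightarrow> real) \<Rightarrow> bool" where
  "strongly_convex \<mu> f \<longleftrightarrow>
     (\<forall>x y. \<forall>\<theta>\<in>{0..1}. f (\<theta> *\<^sub>R x + (1 - \<theta>) *\<^sub>R y)
        \<le> \<theta> * f x + (1 - \<theta>) * f y - \<mu> / 2 * \<theta> * (1 - \<theta>) * (norm (x - y))\<^sup>2)"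

definition proper_function :: "('a \<Rightarrow> ereal) \<Rightarrow> bool" where
  "proper_function f \<longleftrightarrow> (\<exists>x. f x < \<infinity>) \<and> (\<forall>x. f x \<noteq> -\<infinity>)"

definition convex_conjugate :: "('a::euclidean_space \<Rightarrow> real) \<Rightarrow> 'a \<Rightarrow> ereal" where
  "convex_conjugate f s = (SUP x. ereal (s \<bullet> x - f x))"

text \<open>In both problems \<open>q\<close> stands for the vector \<open>T x\<^sub>k + b\<close>. Optimal values are extended
  reals, so that finiteness is not built into their definition.\<close>

definition primal_feasible :: "'b::euclidean_space set \<Rightarrow> 'b \<Rightarrow> real \<Rightarrow> ('b \<times> real) set" where
  "primal_feasible K e c = {(s, \<alpha>). e \<bullet> s + \<alpha> = c \<and> s \<in> dual_cone K \<and> \<alpha> \<ge> 0}"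

definition primal_objective :: "'b::euclidean_space \<Rightarrow> 'b \<times> real \<Rightarrow> real" where
  "primal_objective q = (\<lambda>(s, \<alpha>). q \<bullet> s)"

definition primal_value :: "'b::euclidean_space set \<Rightarrow> 'b \<Rightarrow> real \<Rightarrow> 'b \<Rightarrow> ereal" where
  "primal_value K e c q = (INF p \<in> primal_feasible K e c. ereal (primal_objective q p))"

definition primal_optimal :: "'b::euclidean_space set \<Rightarrow> 'b \<Rightarrow> real \<Rightarrow> 'b \<Rightarrow> ('b \<times> real) set" where
  "primal_optimal K e c q =
     {p. is_arg_min (primal_objective q) (\<lambda>p. p \<in> primal_feasible K e c) p}"

definition primal_slater :: "'b::euclidean_space set \<Rightarrow> 'b \<Rightarrow> real \<Rightarrow> bool" where
  "primal_slater K e c \<longleftrightarrow>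
     (\<exists>(s, \<alpha>) \<in> primal_feasible K e c. s \<in> interior (dual_cone K) \<and> \<alpha> > 0)"

definition dual_feasible :: "'b::euclidean_space set \<Rightarrow> 'b \<Rightarrow> 'b \<Rightarrow> (real \<times> 'b) set" where
  "dual_feasible K e q = {(t, z). z = q - t *\<^sub>R e \<and> z \<in> K \<and> t \<le> 0}"

definition dual_objective :: "real \<Rightarrow> real \<times> 'b::euclidean_space \<Rightarrow> real" where
  "dual_objective c = (\<lambda>(t, z). c * t)"

definition dual_value :: "'b::euclidean_space set \<Rightarrow> 'b \<Rightarrow> real \<Rightarrow> 'b \<Rightarrow> ereal" where
  "dual_value K e c q = (SUP p \<in> dual_feasible K e q. ereal (dual_objective c p))"

definition dual_optimal :: "'b::euclidean_space set \<Rightarrow> 'b \<Rightarrow> real \<Rightarrow> 'b \<Rightarrow> (real \<times> 'b) set" where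
  "dual_optimal K e c q =
     {p. is_arg_max (dual_objective c) (\<lambda>p. p \<in> dual_feasible K e q) p}"

definition dual_slater :: "'b::euclidean_space set \<Rightarrow> 'b \<Rightarrow> 'b \<Rightarrow> bool" where
  "dual_slater K e q \<longleftrightarrow> (\<exists>(t, z) \<in> dual_feasible K e q. z \<in> interior K \<and> t < 0)"

end

theory Submission
  imports Defs
begin

text \<open>Write \<open>q = T x\<^sub>k + b\<close>.
  Since \<open>e\<close> is interior to the pointed closed cone \<open>K\<close>, the reals \<open>t\<close> with \<open>q - t e \<in> K\<close> form
  the ray \<open>t \<le> \<lambda>\<^sub>m\<^sub>i\<^sub>n(q)\<close>, so \<open>(S\<^sup>*)\<close> maximises over \<open>t \<le> min 0 \<lambda>\<^sub>m\<^sub>i\<^sub>n(q)\<close>.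
  For feasible points the duality gap is \<open>\<langle>z, s\<rangle> + (-t) \<alpha>\<close>, a sum of two nonnegative terms. It
  vanishes at \<open>(0, c\<^sub>D)\<close> if the optimal \<open>t\<close> is \<open>0\<close>. Otherwise \<open>z\<^sub>o\<^sub>p\<^sub>t\<close> lies on the boundary of \<open>K\<close>
  and a supporting hyperplane there, normalised by \<open>\<langle>e, s\<rangle> = c\<^sub>D\<close>, closes the gap; with \<open>t < 0\<close>
  the gap is zero exactly if \<open>\<alpha> = 0\<close> and \<open>\<langle>z\<^sub>o\<^sub>p\<^sub>t, s\<rangle> = 0\<close>.\<close>

section \<open>Interior points of a convex cone\<close>

lemma convex_cone_interior_add:
  fixes K :: "'a::real_normed_vector set"
  assumes "convex_cone K" "x \<in> K" "y \<in> interior K"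
  shows "x + y \<in> interior K"
proof -
  \<comment> \<open>The translate of \<open>interior K\<close> by \<open>x\<close> is open, so lying
    in \<open>K\<close> already puts it inside \<open>interior K\<close>.\<close>
  have "(+) x ` interior K \<subseteq> K"
    using assms(1,2) interior_subset by (blast intro: convex_cone_add)
  then have "(+) x ` interior K \<subseteq> interior K"
    by (simp add: interior_maximal open_translation)
  then show ?thesis
    using assms(3) by blast
qed

lemma convex_cone_interior_scaleR:
  fixes K :: "'a::real_normed_vector set"
  assumes "convex_cone K" "c > 0" "y \<in> interior K"
  shows "c *\<^sub>R y \<in> interior K"
proof -
  have "(*\<^sub>R) c ` interior K \<subseteq> K"
    using assms(1,2) interior_subset by (force intro: convex_cone_scaleR)
  then have "(*\<^sub>R) c ` interior K \<subseteq> interior K"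
    using assms(2) by (simp add: interior_maximal open_scaling)
  then show ?thesis
    using assms(3) by blast
qed

lemma interior_perturb:
  fixes e q :: "'a::real_normed_vector"
  assumes "e \<in> interior K"
  obtains \<delta> where "\<delta> > 0" "e + \<delta> *\<^sub>R q \<in> K"
proof -
  obtain r where r: "r > 0" "ball e r \<subseteq> K"
    using assms by (auto simp: mem_interior)
  \<comment> \<open>Adding 1 to \<open>norm q\<close> covers \<open>q = 0\<close> and makes
    \<open>\<delta> * norm q\<close> strictly smaller than \<open>r\<close>.\<close>
  define \<delta> where "\<delta> = r / (norm q + 1)"
  have pos: "norm q + 1 > 0"
    by (smt (verit) norm_ge_zero)
  have "\<delta> > 0"
    using r pos by (simp add: \<delta>_def)
  moreover have "\<delta> * norm q < r"
    using r pos by (simp add: \<delta>_def field_simps)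
  then have "e + \<delta> *\<^sub>R q \<in> ball e r"
    using \<open>\<delta> > 0\<close> by (simp add: dist_norm)
  ultimately show ?thesis
    using r that by blast
qed

text \<open>A small step from \<open>e\<close> in direction \<open>q\<close> stays in
  \<open>K\<close>; rescaling it to a full \<open>q\<close> leaves \<open>1/\<delta>\<close> copies
  of \<open>e\<close>, whence \<open>t = - (1/\<delta>)\<close>.\<close>

lemma convex_cone_absorbing:
  fixes e q :: "'a::real_normed_vector"
  assumes "convex_cone K" "e \<in> interior K"
  obtains t where "t < 0" "q - t *\<^sub>R e \<in> K"
proof -
  obtain \<delta> where \<delta>: "\<delta> > 0" "e + \<delta> *\<^sub>R q \<in> K"
    using assms(2) by (rule interior_perturb)
  have "(1/\<delta>) *\<^sub>R (e + \<delta> *\<^sub>R q) \<in> K"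
    using \<delta> assms(1) by (intro convex_cone_scaleR) auto
  also have "(1/\<delta>) *\<^sub>R (e + \<delta> *\<^sub>R q) = q - (- (1/\<delta>)) *\<^sub>R e"
    using \<delta> by (simp add: scaleR_add_right)
  finally show ?thesis
    using \<delta> that[of "- (1/\<delta>)"] by simp
qed

section \<open>Pointedness and the minimum eigenvalue\<close>

lemma regular_cone_pointed:
  assumes "regular_cone K" "x \<in> K" "- x \<in> K"
  shows "x = 0"
proof -
  have "x \<in> K \<inter> uminus ` K"
    using assms(2,3) by (auto intro: image_eqI[of _ _ "- x"])
  then show ?thesis
    using assms(1) by (auto simp: regular_cone_def)
qed

text \<open>Otherwise pointedness gives \<open>e = 0\<close>, so \<open>0\<close> is interior and
  \<open>K\<close> is the whole space; pointedness then collapses the space to \<open>0\<close>, but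
  it has a nonzero basis vector.\<close>

lemma regular_cone_uminus_interior:
  fixes e :: "'a::euclidean_space"
  assumes "convex_cone K" "regular_cone K" "e \<in> interior K"
  shows "- e \<notin> K"
proof
  assume "- e \<in> K"
  moreover have "e \<in> K"
    using assms(3) interior_subset by blast
  ultimately have "e = 0"
    using regular_cone_pointed assms(2) by blast
  then have "x \<in> K" for x
    using convex_cone_absorbing[OF assms(1,3), of x] by auto
  then have "x = 0" for x :: 'a
    using regular_cone_pointed assms(2) by blast
  then show False
    by (metis SOME_Basis nonzero_Basis)
qed

text \<open>The admissible \<open>t\<close> are closed downwards because \<open>e\<close> lies in
  \<open>K\<close>, bounded above because \<open>- e\<close> does not, and form a closed set because
  \<open>K\<close> is closed; hence the supremum is attained.\<close>

lemma mem_cone_iff_le_min_eigenvalue: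
  fixes e q :: "'a::euclidean_space"
  assumes "convex_cone K" "closed K" "regular_cone K" "e \<in> interior K"
  shows "q - t *\<^sub>R e \<in> K \<longleftrightarrow> t \<le> min_eigenvalue K e q"
proof -
  define S where "S = {t. q - t *\<^sub>R e \<in> K}"
  have eK: "e \<in> K"
    using assms(4) interior_subset by blast
  have down: "s \<in> S" if "t \<in> S" "s \<le> t" for s t
  proof -
    have "(q - t *\<^sub>R e) + (t - s) *\<^sub>R e \<in> K"
      using that eK assms(1) by (intro convex_cone_add convex_cone_scaleR) (auto simp: S_def)
    then show ?thesis
      by (simp add: S_def algebra_simps)
  qed
  obtain t0 where t0: "t0 \<in> S"
    using convex_cone_absorbing[OF assms(1,4), of q] by (auto simp: S_def)
  obtain u where u: "- q - u *\<^sub>R e \<in> K"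
    using convex_cone_absorbing[OF assms(1,4), of "- q"] by auto
  have upper: "t \<le> - u" if "t \<in> S" for t
  proof (rule ccontr)
    assume "\<not> t \<le> - u"
    then have pos: "t + u > 0"
      by simp
    \<comment> \<open>Adding the two members of \<open>K\<close> cancels \<open>q\<close> and leaves
      a positive multiple of \<open>- e\<close>.\<close>
    have "(1 / (t + u)) *\<^sub>R ((q - t *\<^sub>R e) + (- q - u *\<^sub>R e)) \<in> K"
      using that u pos assms(1)
      by (intro convex_cone_add convex_cone_scaleR) (auto simp: S_def)
    also have "(q - t *\<^sub>R e) + (- q - u *\<^sub>R e) = (t + u) *\<^sub>R (- e)"
      by (simp add: algebra_simps)
    finally show False
      using pos regular_cone_uminus_interior[OF assms(1,3,4)] by simp
  qed
  have bdd: "bdd_above S"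
    using upper by (rule bdd_aboveI)
  have "closed ((\<lambda>t. q - t *\<^sub>R e) -` K)"
    by (intro closed_vimage assms continuous_intros)
  then have "closed S"
    by (simp add: S_def vimage_def)
  then have "Sup S \<in> S"
    using t0 bdd by (intro closed_contains_Sup) auto
  then have "t \<in> S \<longleftrightarrow> t \<le> Sup S"
    using down bdd by (blast intro: cSup_upper)
  then show ?thesis
    by (simp add: S_def min_eigenvalue_def)
qed

section \<open>The dual cone: positivity, interior and supporting vectors\<close>

lemma convex_cone_dual_cone: "convex_cone (dual_cone K)"
  by (simp add: convex_cone_iff dual_cone_def inner_add_right)

lemma dual_cone_inner_nonneg:
  assumes "z \<in> K" "s \<in> dual_cone K"
  shows "z \<bullet> s \<ge> 0"
  using assms by (simp add: dual_cone_def)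

text \<open>A small step from \<open>e\<close> along \<open>- y\<close> stays in \<open>K\<close>;
  pairing with \<open>y\<close> bounds \<open>e \<bullet> y\<close> below by
  \<open>\<delta> * (y \<bullet> y)\<close>. This allows dual vectors to be normalised against
  \<open>e\<close>.\<close>

lemma dual_cone_inner_interior_pos:
  fixes e :: "'a::euclidean_space"
  assumes "e \<in> interior K" "y \<in> dual_cone K" "y \<noteq> 0"
  shows "e \<bullet> y > 0"
proof -
  obtain \<delta> where \<delta>: "\<delta> > 0" "e + \<delta> *\<^sub>R (- y) \<in> K"
    using assms(1) by (rule interior_perturb)
  then have "(e + \<delta> *\<^sub>R (- y)) \<bullet> y \<ge> 0"
    using assms(2) by (intro dual_cone_inner_nonneg)
  moreover have "\<delta> * (y \<bullet> y) > 0"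
    using \<delta> assms(3) by simp
  ultimately show ?thesis
    by (simp add: inner_diff_left)
qed

text \<open>A hyperplane strictly separating \<open>0\<close> from the compact convex hull of the unit vectors
  of \<open>K\<close> remains separating when its normal is perturbed slightly.\<close>
lemma interior_dual_cone_nonempty:
  fixes K :: "'a::euclidean_space set"
  assumes "convex_cone K" "closed K" "regular_cone K"
  shows "interior (dual_cone K) \<noteq> {}"
proof -
  define H where "H = convex hull (K \<inter> sphere 0 1)"
  \<comment> \<open>Two nonzero members of a pointed cone cannot cancel, so the hull
    \<open>H\<close> avoids \<open>0\<close>.\<close>
  have "convex (K - {0})"
  proof (rule convexI)
    fix x y and u v :: real
    assume x: "x \<in> K - {0}" and y: "y \<in> K - {0}" and uv: "0 \<le> u" "0 \<le> v" "u + v = 1"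
    have inK: "u *\<^sub>R x \<in> K" "v *\<^sub>R y \<in> K"
      using x y uv assms(1) by (auto intro: convex_cone_scaleR)
    have "u *\<^sub>R x + v *\<^sub>R y \<noteq> 0"
    proof
      assume "u *\<^sub>R x + v *\<^sub>R y = 0"
      then have "- (u *\<^sub>R x) = v *\<^sub>R y"
        by (simp add: neg_eq_iff_add_eq_0)
      then have "u *\<^sub>R x = 0" and "v *\<^sub>R y = 0"
        using inK regular_cone_pointed[OF assms(3), of "u *\<^sub>R x"] by auto
      then show False
        using x y uv by auto
    qed
    then show "u *\<^sub>R x + v *\<^sub>R y \<in> K - {0}"
      using inK assms(1) convex_cone_add by blast
  qed
  then have "H \<subseteq> K - {0}"
    unfolding H_def by (intro hull_minimal) auto
  moreover have "compact H"
    unfolding H_def using assms(2) by (intro compact_convex_hull closed_Int_compact) auto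
  ultimately obtain a \<beta> where a: "\<beta> > 0" "\<forall>x\<in>H. a \<bullet> x > \<beta>"
    using separating_hyperplane_closed_0[of H]
    by (metis Diff_iff H_def compact_imp_closed convex_convex_hull insertI1 subsetD)
  \<comment> \<open>The radius is the separation margin: against a unit vector, replacing
    \<open>a\<close> by \<open>y\<close> loses less than \<open>\<beta>\<close>.\<close>
  have "ball a \<beta> \<subseteq> dual_cone K"
  proof
    fix y assume y: "y \<in> ball a \<beta>"
    have "x \<bullet> y \<ge> 0" if "x \<in> K" for x
    proof (cases "x = 0")
      case False
      define w where "w = (1 / norm x) *\<^sub>R x"
      have "w \<in> K" "norm w = 1"
        using that False assms(1) by (auto simp: w_def intro: convex_cone_scaleR)
      then have "w \<in> H"
        by (auto simp: H_def intro: hull_inc)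
      then have "a \<bullet> w > \<beta>"
        using a by blast
      moreover have "a \<bullet> w - y \<bullet> w \<le> norm (a - y)"
        using norm_cauchy_schwarz[of "a - y" w] \<open>norm w = 1\<close>
        by (simp add: inner_diff_left)
      moreover have "norm (a - y) < \<beta>"
        using y by (simp add: dist_norm)
      ultimately have "w \<bullet> y > 0"
        by (simp add: inner_commute[of w])
      then have "norm x * (w \<bullet> y) \<ge> 0"
        by simp
      then show ?thesis
        using False by (simp add: w_def)
    qed simp
    then show "y \<in> dual_cone K"
      by (simp add: dual_cone_def)
  qed
  then have "a \<in> interior (dual_cone K)"
    using a by (auto simp: mem_interior)
  then show ?thesis
    by blast
qed

text \<open>A hyperplane separating \<open>z\<close> from \<open>interior K\<close> bounds all of
  \<open>K\<close>, which lies in the closure of its interior. So its normal is minimised over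
  \<open>K\<close> at \<open>z\<close>, and homogeneity forces the minimum to be
  \<open>0\<close>.\<close>

lemma supporting_dual_vector:
  fixes K :: "'a::euclidean_space set"
  assumes "convex_cone K" "interior K \<noteq> {}" "z \<in> K" "z \<notin> interior K"
  obtains y where "y \<noteq> 0" "y \<in> dual_cone K" "z \<bullet> y = 0"
proof -
  have conv: "convex K"
    using assms(1) by (simp add: convex_cone_def)
  obtain a \<beta> where a: "a \<noteq> 0" "a \<bullet> z \<le> \<beta>" "\<forall>x\<in>interior K. a \<bullet> x \<ge> \<beta>"
    using separating_hyperplane_sets[of "{z}" "interior K"] assms(2,4) conv convex_interior
    by auto
  have "closure (interior K) \<subseteq> {x. a \<bullet> x \<ge> \<beta>}"
    using a(3) by (intro closure_minimal closed_halfspace_ge) auto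
  then have "K \<subseteq> {x. a \<bullet> x \<ge> \<beta>}"
    using convex_closure_interior[OF conv assms(2)] closure_subset by blast
  then have min: "a \<bullet> z \<le> a \<bullet> x" if "x \<in> K" for x
    using a(2) that by force
  \<comment> \<open>Comparison with \<open>2 *\<^sub>R z\<close> gives
    \<open>a \<bullet> z \<ge> 0\<close>, comparison with \<open>0\<close> gives the
    reverse.\<close>
  have "2 *\<^sub>R z \<in> K" "0 \<in> K"
    using assms(1,3) by (auto intro: convex_cone_scaleR convex_cone_contains_0)
  then have az: "a \<bullet> z = 0"
    using min[of "2 *\<^sub>R z"] min[of 0] by simp
  then have "a \<in> dual_cone K"
    using min by (simp add: dual_cone_def inner_commute)
  then show ?thesis
    using that a(1) az by (simp add: inner_commute)
qed

section \<open>Slater points of both problems\<close>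

lemma primal_slater_regular_cone:
  fixes K :: "'a::euclidean_space set"
  assumes "convex_cone K" "closed K" "regular_cone K" "c > 0"
  shows "primal_slater K e c"
proof -
  obtain s where s: "s \<in> interior (dual_cone K)"
    using interior_dual_cone_nonempty[OF assms(1-3)] by blast
  \<comment> \<open>Shrinking \<open>s\<close> leaves a strictly positive slack
    \<open>\<alpha>\<close>; the absolute value and the added 1 handle every sign of
    \<open>e \<bullet> s\<close>, including zero.\<close>
  define r where "r = c / (\<bar>e \<bullet> s\<bar> + 1)"
  have r: "r > 0"
    using assms(4) by (simp add: r_def)
  have "r * (e \<bullet> s) \<le> r * \<bar>e \<bullet> s\<bar>"
    using r by (intro mult_left_mono) auto
  also have "\<dots> < c"
    using assms(4) by (simp add: r_def field_simps)
  finally have "c - e \<bullet> (r *\<^sub>R s) > 0"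
    by simp
  moreover have "r *\<^sub>R s \<in> interior (dual_cone K)"
    using r s by (intro convex_cone_interior_scaleR convex_cone_dual_cone)
  moreover from this have "r *\<^sub>R s \<in> dual_cone K"
    using interior_subset by blast
  ultimately show ?thesis
    unfolding primal_slater_def primal_feasible_def
    by (intro bexI[of _ "(r *\<^sub>R s, c - e \<bullet> (r *\<^sub>R s))"]) auto
qed

lemma dual_slater_regular_cone:
  fixes K :: "'a::euclidean_space set"
  assumes "convex_cone K" "e \<in> interior K"
  shows "dual_slater K e q"
proof -
  obtain t where t: "t < 0" "q - t *\<^sub>R e \<in> K"
    using convex_cone_absorbing[OF assms] .
  \<comment> \<open>One further copy of \<open>e\<close> moves the point from \<open>K\<close> into
    its interior and lowers \<open>t\<close> to \<open>t - 1\<close>.\<close>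
  have "(q - t *\<^sub>R e) + e \<in> interior K"
    using assms t by (intro convex_cone_interior_add)
  then have "q - (t - 1) *\<^sub>R e \<in> interior K"
    by (simp add: algebra_simps)
  moreover from this have "q - (t - 1) *\<^sub>R e \<in> K"
    using interior_subset by blast
  ultimately show ?thesis
    unfolding dual_slater_def dual_feasible_def using t
    by (intro bexI[of _ "(t - 1, q - (t - 1) *\<^sub>R e)"]) auto
qed

section \<open>Weak and strong duality\<close>

lemma duality_gap:
  assumes "(s, \<alpha>) \<in> primal_feasible K e c"
  shows "q \<bullet> s - c * t = (q - t *\<^sub>R e) \<bullet> s + (- t) * \<alpha>"
proof -
  have "c = e \<bullet> s + \<alpha>"
    using assms by (simp add: primal_feasible_def)
  then show ?thesis
    by (simp add: algebra_simps inner_diff_left)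
qed

lemma weak_duality:
  assumes "p \<in> primal_feasible K e c" "d \<in> dual_feasible K e q"
  shows "dual_objective c d \<le> primal_objective q p"
proof -
  obtain s \<alpha> where p: "p = (s, \<alpha>)" "s \<in> dual_cone K" "\<alpha> \<ge> 0"
    using assms(1) by (auto simp: primal_feasible_def)
  obtain t where d: "d = (t, q - t *\<^sub>R e)" "q - t *\<^sub>R e \<in> K" "t \<le> 0"
    using assms(2) by (auto simp: dual_feasible_def)
  have "(q - t *\<^sub>R e) \<bullet> s \<ge> 0" "(- t) * \<alpha> \<ge> 0"
    using p d dual_cone_inner_nonneg by (auto intro: mult_nonpos_nonneg)
  then have "c * t \<le> q \<bullet> s"
    using duality_gap[of s \<alpha> K e c q t] assms(1) unfolding p(1) by linarith
  then show ?thesis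
    using p d by (simp add: primal_objective_def dual_objective_def)
qed

lemma strong_duality:
  fixes K :: "'a::euclidean_space set" and e q :: 'a and c :: real
  defines "t \<equiv> min 0 (min_eigenvalue K e q)"
  assumes "convex_cone K" "closed K" "regular_cone K" "e \<in> interior K" "c > 0"
  obtains p where "p \<in> primal_feasible K e c" "primal_objective q p = c * t"
proof (cases "t = 0")
  case True
  have "(0, c) \<in> primal_feasible K e c"
    using assms(6) by (simp add: primal_feasible_def dual_cone_def)
  then show ?thesis
    using True that[of "(0, c)"] by (simp add: primal_objective_def)
next
  case False
  note mem = mem_cone_iff_le_min_eigenvalue[OF assms(2-5), of q]
  from False have t: "t = min_eigenvalue K e q"
    by (auto simp: t_def min_def split: if_splits)
  define z where "z = q - t *\<^sub>R e"
  have "z \<in> K"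
    by (simp add: z_def mem t)
  \<comment> \<open>From an interior \<open>z\<close> one could still subtract a little of
    \<open>e\<close>, pushing \<open>t\<close> beyond the minimum eigenvalue.\<close>
  moreover have "z \<notin> interior K"
  proof
    assume "z \<in> interior K"
    then obtain \<delta> where \<delta>: "\<delta> > 0" "z + \<delta> *\<^sub>R (- e) \<in> K"
      by (rule interior_perturb)
    then have "q - (t + \<delta>) *\<^sub>R e \<in> K"
      by (simp add: z_def algebra_simps)
    then show False
      using \<delta> by (simp only: mem t)
  qed
  moreover have "interior K \<noteq> {}"
    using assms(5) by blast
  ultimately obtain y where y: "y \<noteq> 0" "y \<in> dual_cone K" "z \<bullet> y = 0"
    using supporting_dual_vector assms(2) by metis
  have ey: "e \<bullet> y > 0"
    using dual_cone_inner_interior_pos[OF assms(5)] y by blast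
  \<comment> \<open>The factor makes \<open>e \<bullet> s = c\<close>, so the slack is
    \<open>\<alpha> = 0\<close> and both terms of the gap vanish.\<close>
  define s where "s = (c / (e \<bullet> y)) *\<^sub>R y"
  have "s \<in> dual_cone K"
    unfolding s_def using ey y assms(6)
    by (intro convex_cone_scaleR convex_cone_dual_cone) auto
  moreover have "e \<bullet> s = c"
    using ey by (simp add: s_def)
  ultimately have feas: "(s, 0) \<in> primal_feasible K e c"
    by (simp add: primal_feasible_def)
  have "z \<bullet> s = 0"
    using y by (simp add: s_def)
  then have "q \<bullet> s = c * t"
    using duality_gap[OF feas, of q t] by (simp add: z_def)
  then show ?thesis
    using feas that by (simp add: primal_objective_def)
qed

section \<open>Optimal values and solution sets\<close>

theorem theorem4p3:
  fixes K :: "'b::euclidean_space set"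
    and e b y\<^sub>k z_opt :: 'b
    and c\<^sub>D \<mu> t_opt :: real
    and f :: "'a::euclidean_space \<Rightarrow> real"
    and T :: "'a \<Rightarrow> 'b"
    and x\<^sub>k :: 'a
  assumes "convex_cone K" "closed K" "regular_cone K"
    and "e \<in> interior K"
    and "c\<^sub>D > 0"
    and "closed (epigraph UNIV f)" "proper_function (\<lambda>x. ereal (f x))"
    and "\<mu> > 0" "strongly_convex \<mu> f"
    and "linear T"
    and "y\<^sub>k \<in> dual_cone K" "e \<bullet> y\<^sub>k \<le> c\<^sub>D"
    and "GDERIV (\<lambda>s. real_of_ereal (convex_conjugate f s)) (adjoint T y\<^sub>k) :> x\<^sub>k"
    and t_opt: "t_opt = min 0 (min_eigenvalue K e (T x\<^sub>k + b))"
    and z_opt: "z_opt = T x\<^sub>k + b - t_opt *\<^sub>R e"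
  shows
    "(primal_slater K e c\<^sub>D \<and> dual_slater K e (T x\<^sub>k + b)
      \<and> primal_value K e c\<^sub>D (T x\<^sub>k + b) = dual_value K e c\<^sub>D (T x\<^sub>k + b)
      \<and> (\<exists>p \<in> primal_feasible K e c\<^sub>D.
            ereal (primal_objective (T x\<^sub>k + b) p) = primal_value K e c\<^sub>D (T x\<^sub>k + b))
      \<and> (\<exists>p \<in> dual_feasible K e (T x\<^sub>k + b).
            ereal (dual_objective c\<^sub>D p) = dual_value K e c\<^sub>D (T x\<^sub>k + b)))
    \<and> dual_optimal K e c\<^sub>D (T x\<^sub>k + b) = {(t_opt, z_opt)}
    \<and> (t_opt = 0 \<longrightarrow> (0, c\<^sub>D) \<in> primal_optimal K e c\<^sub>D (T x\<^sub>k + b))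
    \<and> (t_opt < 0 \<longrightarrow>
          {s. \<exists>\<alpha>. (s, \<alpha>) \<in> primal_optimal K e c\<^sub>D (T x\<^sub>k + b)}
            = {s \<in> dual_cone K. e \<bullet> s = c\<^sub>D \<and> s \<bullet> z_opt = 0}
        \<and> {s \<in> dual_cone K. e \<bullet> s = c\<^sub>D \<and> s \<bullet> z_opt = 0}
            = {s \<in> conjugate_face K z_opt. e \<bullet> s = c\<^sub>D})"
proof -
  define q where "q = T x\<^sub>k + b"
  note cone = assms(1-4) and c = \<open>c\<^sub>D > 0\<close>
  note tq = t_opt[folded q_def] and zq = z_opt[folded q_def]
  let ?P = "primal_feasible K e c\<^sub>D" and ?D = "dual_feasible K e q"
  \<comment> \<open>The cone constraint and \<open>t \<le> 0\<close> merge into the single bound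
    \<open>t \<le> t_opt\<close>.\<close>
  have D: "?D = {(t, z). z = q - t *\<^sub>R e \<and> t \<le> t_opt}"
    by (auto simp: dual_feasible_def mem_cone_iff_le_min_eigenvalue[OF cone] tq)
  have dopt: "(t_opt, z_opt) \<in> ?D" "dual_objective c\<^sub>D (t_opt, z_opt) = c\<^sub>D * t_opt"
    by (auto simp: D zq dual_objective_def)
  \<comment> \<open>\<open>p\<close> and \<open>(t_opt, z_opt)\<close> have equal objective values,
    so by weak duality each certifies the optimality of the other.\<close>
  obtain p where p: "p \<in> ?P" "primal_objective q p = c\<^sub>D * t_opt"
    using strong_duality[OF cone c] tq by metis
  have lower: "c\<^sub>D * t_opt \<le> primal_objective q p'" if "p' \<in> ?P" for p'
    using weak_duality[OF that dopt(1)] dopt(2) by simp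
  have upper: "dual_objective c\<^sub>D d \<le> c\<^sub>D * t_opt" if "d \<in> ?D" for d
    using weak_duality[OF p(1) that] p(2) by simp
  have pval: "primal_value K e c\<^sub>D q = ereal (c\<^sub>D * t_opt)"
    unfolding primal_value_def using p lower
    by (intro antisym INF_greatest INF_lower2[of p]) auto
  have dval: "dual_value K e c\<^sub>D q = ereal (c\<^sub>D * t_opt)"
    unfolding dual_value_def using dopt upper
    by (intro antisym SUP_least SUP_upper2[of "(t_opt, z_opt)"]) auto
  have dual_opt: "dual_optimal K e c\<^sub>D q = {(t_opt, z_opt)}"
  proof -
    have "dual_optimal K e c\<^sub>D q = {d \<in> ?D. dual_objective c\<^sub>D d = c\<^sub>D * t_opt}"
      unfolding dual_optimal_def is_arg_max_def using dopt upper by force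
    \<comment> \<open>Uniqueness: \<open>c\<^sub>D > 0\<close> lets the value determine
      \<open>t\<close>, and \<open>t\<close> determines \<open>z\<close>.\<close>
    also have "\<dots> = {(t_opt, z_opt)}"
      using c by (auto simp: D zq dual_objective_def)
    finally show ?thesis .
  qed
  have popt: "primal_optimal K e c\<^sub>D q = {p \<in> ?P. primal_objective q p = c\<^sub>D * t_opt}"
    unfolding primal_optimal_def is_arg_min_def using p lower
    by (intro Collect_cong) (metis antisym not_less)
  have zero: "(0, c\<^sub>D) \<in> primal_optimal K e c\<^sub>D q" if "t_opt = 0"
    using that c by (simp add: popt primal_feasible_def dual_cone_def primal_objective_def)
  have slack: "(s, \<alpha>) \<in> primal_optimal K e c\<^sub>D q \<longleftrightarrow>
      s \<in> dual_cone K \<and> e \<bullet> s = c\<^sub>D \<and> s \<bullet> z_opt = 0 \<and> \<alpha> = 0" if neg: "t_opt < 0" for s \<alpha>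
  proof -
    have "q \<bullet> s = c\<^sub>D * t_opt \<longleftrightarrow> z_opt \<bullet> s = 0 \<and> \<alpha> = 0" if feas: "(s, \<alpha>) \<in> ?P"
    proof -
      have "z_opt \<in> K"
        using dopt(1) by (auto simp: dual_feasible_def)
      then have "z_opt \<bullet> s \<ge> 0" "(- t_opt) * \<alpha> \<ge> 0"
        using feas neg
        by (auto simp: primal_feasible_def mult_nonpos_nonneg intro: dual_cone_inner_nonneg)
      then show ?thesis
        using duality_gap[OF feas, of q t_opt] neg by (auto simp: zq)
    qed
    \<comment> \<open>With \<open>\<alpha> = 0\<close>, the equality constraint reads
      \<open>e \<bullet> s = c\<^sub>D\<close>.\<close>
    then show ?thesis
      by (auto simp: popt primal_objective_def inner_commute primal_feasible_def)
  qed
  have "{s. \<exists>\<alpha>. (s, \<alpha>) \<in> primal_optimal K e c\<^sub>D q}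
      = {s \<in> dual_cone K. e \<bullet> s = c\<^sub>D \<and> s \<bullet> z_opt = 0}" if "t_opt < 0"
    using slack[OF that] by auto
  moreover have "{s \<in> dual_cone K. e \<bullet> s = c\<^sub>D \<and> s \<bullet> z_opt = 0}
      = {s \<in> conjugate_face K z_opt. e \<bullet> s = c\<^sub>D}"
    by (auto simp: conjugate_face_def)
  moreover have "primal_slater K e c\<^sub>D" "dual_slater K e q"
    using primal_slater_regular_cone dual_slater_regular_cone cone c by blast+
  moreover have "\<exists>p\<in>?P. ereal (primal_objective q p) = primal_value K e c\<^sub>D q"
    using p pval by auto
  moreover have "\<exists>d\<in>?D. ereal (dual_objective c\<^sub>D d) = dual_value K e c\<^sub>D q"
    using dopt dval by metis
  ultimately show ?thesis
    unfolding q_def[symmetric] using pval dval dual_opt zero by simp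
qed

end
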